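(* Let $\Gamma$ be a finitely generated group with finite generating set $X$. If $$\limsup_{n \to \infty} \frac{(\log \mathrm{F}_{\Gamma,X}(n))^2}{\log\log n} = 0,$$ then $\Gamma$ is finite. In particular, if $\Gamma$ is infinite, then $e^{\sqrt{\log\log n}} \preceq \mathrm{F}_{\Gamma,X}(n)$.
   Context: For a group $\Gamma$ and $g \in \Gamma$ with $g \neq 1$, the normal divisibility function is $\mathrm{D}_\Gamma(g) = \min\{[\Gamma:\Delta] : \Delta \lhd \Gamma,\ g \notin \Delta\}$, where $\Delta$ ranges over normal subgroups of finite index (the value is $\infty$ if no such $\Delta$ exists). For a finite generating set $X$ of $\Gamma$ and a real number $n>0$, let $B^\bullet_{\Gamma,X}(n)$ be the set of non-identity elements of $\Gamma$ of word length at most $n$ with respect to $X$, and define $\mathrm{F}_{\Gamma,X}(n) = \max\{\mathrm{D}_\Gamma(g) : g \in B^\bullet_{\Gamma,X}(n)\}$ (a maximum over the empty set is read as $1$). For functions $f,g$, write $f \preceq g$ (or $f(n) \preceq g(n)$) if there exists $C>0$ such that $f(n) \leq C\, g(Cn)$ for all sufficiently large $n$. *)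

theory Defs
  imports "HOL-Analysis.Analysis" "HOL-Algebra.Generated_Groups"
begin

(* The infimum is taken in enat: it is the minimum of a nonempty set of indices,
   and \<infinity> if no normal subgroup of finite index omits g. *)
definition normal_divisibility :: "('a, 'b) monoid_scheme \<Rightarrow> 'a \<Rightarrow> enat" where
  "normal_divisibility G g =
     Inf {enat (card (rcosets\<^bsub>G\<^esub> N)) | N. N \<lhd> G \<and> finite (rcosets\<^bsub>G\<^esub> N) \<and> g \<notin> N}"

(* Only meaningful for g in the subgroup generated by S. *)
definition word_length :: "('a, 'b) monoid_scheme \<Rightarrow> 'a set \<Rightarrow> 'a \<Rightarrow> nat" where
  "word_length G S g =
     (LEAST k. \<exists>ws. set ws \<subseteq> S \<union> m_inv G ` S \<and> length ws = k
        \<and> foldr (\<otimes>\<^bsub>G\<^esub>) ws \<one>\<^bsub>G\<^esub> = g)"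

definition punctured_ball :: "('a, 'b) monoid_scheme \<Rightarrow> 'a set \<Rightarrow> real \<Rightarrow> 'a set" where
  "punctured_ball G S n = {g \<in> carrier G - {\<one>\<^bsub>G\<^esub>}. real (word_length G S g) \<le> n}"

(* For a finite generating set S the ball is finite, so the supremum is a maximum. *)
definition divisibility_growth :: "('a, 'b) monoid_scheme \<Rightarrow> 'a set \<Rightarrow> real \<Rightarrow> enat" where
  "divisibility_growth G S n =
     (if punctured_ball G S n = {} then 1
      else (SUP g\<in>punctured_ball G S n. normal_divisibility G g))"

fun ln_enat :: "enat \<Rightarrow> ereal" where
  "ln_enat (enat k) = ereal (ln (real k))"
| "ln_enat \<infinity> = \<infinity>"

definition asymp_preceq :: "(real \<Rightarrow> ereal) \<Rightarrow> (real \<Rightarrow> ereal) \<Rightarrow> bool" (infix "\<preceq>" 50) where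
  "f \<preceq> g \<longleftrightarrow> (\<exists>C::real. C > 0 \<and> (\<forall>\<^sub>F n in at_top. f n \<le> ereal C * g (C * n)))"

end

theory Submission
  imports Defs "HOL-Real_Asymp.Real_Asymp"
begin

text \<open>Choose a normal subgroup \<open>R\<close> that is maximal among those of infinite index (Zorn). The normal
  closure of any \<open>x \<notin> R\<close> then meets infinitely many cosets of \<open>R\<close>, and \<open>m + 1\<close> of them already in
  elements of length at most \<open>m (|x| + 2)\<close>. For every normal \<open>N\<close> of index at most \<open>m\<close>, two of these
  elements agree modulo \<open>N\<close>; hence some quotient \<open>h\<close> of two of them, which is again outside \<open>R\<close>, lies
  in at least a fraction \<open>1 / (m + 1)\<^sup>2\<close> of the \<open>N\<close> that miss \<open>x\<close>, and in all that contain \<open>x\<close>.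
  There are at most \<open>m\<close> to the power \<open>O(m)\<close> such \<open>N\<close>, so \<open>O(m\<^sup>4)\<close> iterations produce a nontrivial
  element of length \<open>exp (O(m\<^sup>5))\<close> in all of them. This gives \<open>F(n) \<ge> (ln n / c) powr (1/5)\<close> for every
  infinite group, which is stronger than both claims.\<close>

section \<open>Finite index and cosets of normal subgroups\<close>

text \<open>Phrased by a finite set \<open>T\<close> of representatives, possibly with repeated
  cosets, because the arguments below construct such sets explicitly.\<close>

definition has_finite_index :: "('a, 'b) monoid_scheme \<Rightarrow> 'a set \<Rightarrow> bool" where
  "has_finite_index G N \<longleftrightarrow>
     (\<exists>T. finite T \<and> T \<subseteq> carrier G \<and> (\<forall>g\<in>carrier G. \<exists>t\<in>T. g \<otimes>\<^bsub>G\<^esub> inv\<^bsub>G\<^esub> t \<in> N))"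

text \<open>Once \<open>m_assoc\<close> has nested a product to the right, an inverse pair no longer
  stands alone as a subterm; these rules cancel it there.\<close>

lemma (in group) mult_inv_cancel_left:
  assumes "a \<in> carrier G" "b \<in> carrier G"
  shows "inv a \<otimes> (a \<otimes> b) = b" "a \<otimes> (inv a \<otimes> b) = b"
  using assms by (simp_all flip: m_assoc)

lemma (in group) normal_conj:
  "N \<lhd> G \<Longrightarrow> g \<in> carrier G \<Longrightarrow> h \<in> N \<Longrightarrow> g \<otimes> h \<otimes> inv g \<in> N"
  using normal_inv_iff by blast

lemma (in group) normal_rcos_eq_iff:
  assumes "N \<lhd> G" "a \<in> carrier G" "b \<in> carrier G"
  shows "N #> a = N #> b \<longleftrightarrow> a \<otimes> inv b \<in> N"
proof -
  have sub: "subgroup N G" using assms(1) normal_imp_subgroup by blast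
  show ?thesis
  proof
    assume "N #> a = N #> b"
    then have "a \<in> N #> b" using rcos_self[OF assms(2) sub] by simp
    then obtain h where h: "h \<in> N" "a = h \<otimes> b" by (auto simp: r_coset_def)
    then have "h \<in> carrier G" using sub subgroup.subset by blast
    then show "a \<otimes> inv b \<in> N" using h assms by (simp add: m_assoc)
  next
    assume h: "a \<otimes> inv b \<in> N"
    have "a = (a \<otimes> inv b) \<otimes> b" using assms by (simp add: m_assoc)
    then have "a \<in> N #> b" using h unfolding r_coset_def by blast
    then show "N #> a = N #> b" using repr_independence[OF _ assms(3) sub] by simp
  qed
qed

lemma (in group) normal_rcosetsI: "N \<lhd> G \<Longrightarrow> g \<in> carrier G \<Longrightarrow> N #> g \<in> rcosets N"
  using rcosetsI[OF subgroup.subset[OF normal_imp_subgroup]] .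

section \<open>Words and word balls in a finitely generated group\<close>

locale finitely_generated_group = group G for G (structure) +
  fixes S :: "'a set"
  assumes fin_S: "finite S" and S_carrier: "S \<subseteq> carrier G" and gen_S: "generate G S = carrier G"
begin

definition letters :: "'a set" where
  "letters = S \<union> m_inv G ` S"

definition word_ball :: "nat \<Rightarrow> 'a set" where
  "word_ball k = {foldr (\<otimes>) ws \<one> | ws. set ws \<subseteq> letters \<and> length ws \<le> k}"

lemma finite_letters: "finite letters"
  using fin_S by (simp add: letters_def)

lemma letters_carrier: "letters \<subseteq> carrier G"
  using S_carrier by (auto simp: letters_def)

lemma letters_inv: "s \<in> letters \<Longrightarrow> inv s \<in> letters"
  using S_carrier by (auto simp: letters_def)

lemma foldr_carrier: "set ws \<subseteq> letters \<Longrightarrow> foldr (\<otimes>) ws \<one> \<in> carrier G"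
  using letters_carrier by (induction ws) auto

lemma foldr_append:
  assumes "set us \<subseteq> letters" "set vs \<subseteq> letters"
  shows "foldr (\<otimes>) (us @ vs) \<one> = foldr (\<otimes>) us \<one> \<otimes> foldr (\<otimes>) vs \<one>"
  using assms
proof (induction us)
  case (Cons u us)
  then have "u \<in> carrier G" using letters_carrier by auto
  with Cons show ?case using foldr_carrier by (simp add: m_assoc)
qed (use foldr_carrier in simp)

lemma word_ball_carrier: "word_ball k \<subseteq> carrier G"
  using foldr_carrier by (auto simp: word_ball_def)

lemma word_ball_mono: "g \<in> word_ball k \<Longrightarrow> k \<le> l \<Longrightarrow> g \<in> word_ball l"
  unfolding word_ball_def by fastforce

lemma one_in_word_ball: "\<one> \<in> word_ball k"
  unfolding word_ball_def by (rule CollectI, rule exI[of _ "[]"]) simp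

lemma letters_word_ball: "s \<in> letters \<Longrightarrow> s \<in> word_ball 1"
  unfolding word_ball_def using letters_carrier by (intro CollectI exI[of _ "[s]"]) auto

lemma word_ball_mult:
  assumes "g \<in> word_ball k" "h \<in> word_ball l"
  shows "g \<otimes> h \<in> word_ball (k + l)"
proof -
  obtain us vs where "set us \<subseteq> letters" "length us \<le> k" "g = foldr (\<otimes>) us \<one>"
    "set vs \<subseteq> letters" "length vs \<le> l" "h = foldr (\<otimes>) vs \<one>"
    using assms unfolding word_ball_def by blast
  then show ?thesis
    unfolding word_ball_def using foldr_append by (intro CollectI exI[of _ "us @ vs"]) auto
qed

lemma foldr_inv: "set ws \<subseteq> letters \<Longrightarrow> inv (foldr (\<otimes>) ws \<one>) \<in> word_ball (length ws)"
proof (induction ws)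
  case Nil
  show ?case using one_in_word_ball by simp
next
  case (Cons w ws)
  then have "inv (foldr (\<otimes>) ws \<one>) \<otimes> inv w \<in> word_ball (length ws + 1)"
    by (intro word_ball_mult letters_word_ball letters_inv) auto
  moreover have "inv (w \<otimes> foldr (\<otimes>) ws \<one>) = inv (foldr (\<otimes>) ws \<one>) \<otimes> inv w"
    using Cons.prems foldr_carrier letters_carrier by (intro inv_mult_group) auto
  ultimately show ?case by simp
qed

lemma word_ball_inv: "g \<in> word_ball k \<Longrightarrow> inv g \<in> word_ball k"
  using foldr_inv word_ball_mono unfolding word_ball_def by fastforce

lemma carrier_word_ball:
  assumes "g \<in> carrier G"
  obtains k where "g \<in> word_ball k"
proof -
  have "g \<in> generate G S" using assms gen_S by simp
  then have "\<exists>k. g \<in> word_ball k"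
  proof (induction rule: generate.induct)
    case one
    show ?case using one_in_word_ball by (rule exI)
  next
    case (incl h)
    then have "h \<in> letters" by (simp add: letters_def)
    then show ?case by (intro exI[of _ 1] letters_word_ball)
  next
    case (inv h)
    then have "inv h \<in> letters" by (simp add: letters_def)
    then show ?case by (intro exI[of _ 1] letters_word_ball)
  next
    case (eng h1 h2)
    then obtain k l where "h1 \<in> word_ball k" "h2 \<in> word_ball l" by (elim exE)
    then show ?case by (intro exI[of _ "k + l"] word_ball_mult)
  qed
  then show ?thesis using that by (elim exE)
qed

text \<open>Every element is a product of letters, inverses included, so it arises from
  \<open>\<one>\<close> by prepending one letter at a time.\<close>

lemma carrier_induct [consumes 1, case_names one letter]:
  assumes "g \<in> carrier G" "P \<one>"
    and step: "\<And>s g. s \<in> letters \<Longrightarrow> g \<in> carrier G \<Longrightarrow> P g \<Longrightarrow> P (s \<otimes> g)"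
  shows "P g"
proof -
  obtain k where "g \<in> word_ball k" using carrier_word_ball[OF assms(1)] .
  then obtain ws where "set ws \<subseteq> letters" "g = foldr (\<otimes>) ws \<one>"
    unfolding word_ball_def by auto
  moreover have "P (foldr (\<otimes>) ws \<one>)" if "set ws \<subseteq> letters" for ws
    using that
  proof (induction ws)
    case Nil
    show ?case using assms(2) by simp
  next
    case (Cons w ws)
    then show ?case using step[of w "foldr (\<otimes>) ws \<one>"] foldr_carrier[of ws] by simp
  qed
  ultimately show ?thesis by blast
qed

lemma word_length_le: "g \<in> word_ball k \<Longrightarrow> word_length G S g \<le> k"
proof -
  assume "g \<in> word_ball k"
  then obtain ws where ws: "set ws \<subseteq> S \<union> m_inv G ` S" "length ws \<le> k" "foldr (\<otimes>) ws \<one> = g"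
    unfolding word_ball_def letters_def by blast
  have "word_length G S g \<le> length ws"
    unfolding word_length_def by (rule Least_le) (use ws in blast)
  with ws show ?thesis by simp
qed

section \<open>A normal subgroup maximal among those of infinite index\<close>

text \<open>A finite quotient of a finitely generated group is finitely presented, so a normal subgroup of
  finite index in the union of a chain is already reached inside the chain.\<close>

lemma chain_Union_infinite_index:
  assumes ne: "C \<noteq> {}" and chain: "subset.chain {N. N \<lhd> G \<and> \<not> has_finite_index G N} C"
  shows "\<not> has_finite_index G (\<Union>C)"
proof
  assume "has_finite_index G (\<Union>C)"
  then obtain T where T: "finite T" "T \<subseteq> carrier G"
    and cov: "\<And>g. g \<in> carrier G \<Longrightarrow> \<exists>t\<in>T. g \<otimes> inv t \<in> \<Union>C"
    unfolding has_finite_index_def by blast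
  define r where "r g = (SOME t. t \<in> T \<and> g \<otimes> inv t \<in> \<Union>C)" for g
  have r: "r g \<in> T" "g \<otimes> inv (r g) \<in> \<Union>C" if "g \<in> carrier G" for g
    using someI_ex[of "\<lambda>t. t \<in> T \<and> g \<otimes> inv t \<in> \<Union>C", folded r_def] cov[OF that] by auto
  \<comment> \<open>Finitely many relators suffice: \<open>\<one>\<close> starts the induction below
    and the products \<open>s \<otimes> t\<close> drive its step. One member \<open>M\<close> of the
    chain contains \<open>g \<otimes> inv (r g)\<close> for all \<open>g\<close> in
    \<open>E\<close>.\<close>
  define E where "E = insert \<one> ((\<lambda>(s, t). s \<otimes> t) ` (letters \<times> T))"
  have E: "finite E" "E \<subseteq> carrier G"
    using finite_letters letters_carrier T unfolding E_def by auto
  have "finite ((\<lambda>g. g \<otimes> inv (r g)) ` E)" "(\<lambda>g. g \<otimes> inv (r g)) ` E \<subseteq> \<Union>C"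
    using E r(2) by (blast, blast)
  then obtain M where M: "M \<in> C" and Y: "(\<lambda>g. g \<otimes> inv (r g)) ` E \<subseteq> M"
    by (rule finite_subset_Union_chain[OF _ _ ne chain])
  have nor: "M \<lhd> G" and ninf: "\<not> has_finite_index G M"
    using M chain unfolding subset.chain_def by auto
  interpret M: normal M G by (rule nor)
  have "\<exists>t\<in>T. g \<otimes> inv t \<in> M" if "g \<in> carrier G" for g
    using that
  proof (induction rule: carrier_induct)
    case one
    have "\<one> \<in> E" by (simp add: E_def)
    then show ?case using r(1)[of \<one>] Y by auto
  next
    case (letter s g)
    then obtain t where t: "t \<in> T" "g \<otimes> inv t \<in> M" by blast
    have car: "s \<in> carrier G" "t \<in> carrier G" "g \<in> carrier G"
      using letter t T letters_carrier by auto
    have st: "s \<otimes> t \<in> E" using letter t by (auto simp: E_def)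
    define t' where "t' = r (s \<otimes> t)"
    have t': "t' \<in> T" "s \<otimes> t \<otimes> inv t' \<in> M" using r(1)[of "s \<otimes> t"] st Y E(2) unfolding t'_def by auto
    then have car': "t' \<in> carrier G" using T by blast
    have "s \<otimes> (g \<otimes> inv t) \<otimes> inv s \<in> M" using normal_conj[OF nor car(1) t(2)] .
    \<comment> \<open>Conjugating the induction hypothesis by \<open>s\<close> and multiplying by
      the relator of \<open>s \<otimes> t\<close> telescopes to
      \<open>s \<otimes> g \<otimes> inv t'\<close>.\<close>
    then have "(s \<otimes> (g \<otimes> inv t) \<otimes> inv s) \<otimes> (s \<otimes> t \<otimes> inv t') \<in> M"
      using t' by simp
    moreover have "(s \<otimes> (g \<otimes> inv t) \<otimes> inv s) \<otimes> (s \<otimes> t \<otimes> inv t') = s \<otimes> g \<otimes> inv t'"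
      using car car' by (simp add: m_assoc mult_inv_cancel_left)
    ultimately show ?case using t' by auto
  qed
  then have "has_finite_index G M" unfolding has_finite_index_def using T by blast
  then show False using ninf by blast
qed

lemma chain_Union_normal:
  assumes ne: "C \<noteq> {}" and chain: "subset.chain {N. N \<lhd> G \<and> Q N} C"
  shows "\<Union>C \<lhd> G"
proof -
  have nor: "N \<lhd> G" if "N \<in> C" for N using chain that unfolding subset.chain_def by blast
  then have sub: "subgroup N G" if "N \<in> C" for N using that normal_imp_subgroup by blast
  have "subgroup (\<Union>C) G"
  proof (rule subgroupI)
    show "\<Union>C \<subseteq> carrier G" using sub by (auto dest: subgroup.mem_carrier)
    obtain N where "N \<in> C" using ne by blast
    then show "\<Union>C \<noteq> {}" using subgroup.one_closed[OF sub] by blast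
  next
    fix a assume "a \<in> \<Union>C"
    then obtain N where "N \<in> C" "a \<in> N" by blast
    then show "inv a \<in> \<Union>C" using subgroup.m_inv_closed[OF sub] by blast
  next
    fix a b assume "a \<in> \<Union>C" "b \<in> \<Union>C"
    then obtain M N where MN: "M \<in> C" "N \<in> C" "a \<in> M" "b \<in> N" by blast
    then have "M \<subseteq> N \<or> N \<subseteq> M" using chain unfolding subset.chain_def by blast
    then obtain L where "L \<in> C" "a \<in> L" "b \<in> L" using MN by blast
    then show "a \<otimes> b \<in> \<Union>C" using subgroup.m_closed[OF sub] by blast
  qed
  moreover have "g \<otimes> h \<otimes> inv g \<in> \<Union>C" if g: "g \<in> carrier G" and h: "h \<in> \<Union>C" for g h
  proof -
    obtain N where "N \<in> C" "h \<in> N" using h by blast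
    then show ?thesis using normal_conj[OF nor g] by blast
  qed
  ultimately show ?thesis unfolding normal_inv_iff by blast
qed

text \<open>Zorn's lemma: the two preceding lemmas bound the chains, and the family is nonempty
  because the trivial subgroup of an infinite group has infinite index.\<close>

lemma ex_maximal_infinite_index:
  assumes inf: "infinite (carrier G)"
  obtains R where "R \<lhd> G" "\<not> has_finite_index G R"
    and "\<forall>N. N \<lhd> G \<longrightarrow> R \<subset> N \<longrightarrow> has_finite_index G N"
proof -
  let ?A = "{N. N \<lhd> G \<and> \<not> has_finite_index G N}"
  have "\<not> has_finite_index G {\<one>}"
  proof
    assume "has_finite_index G {\<one>}"
    then obtain T where T: "finite T" "T \<subseteq> carrier G"
      "\<forall>g\<in>carrier G. \<exists>t\<in>T. g \<otimes> inv t \<in> {\<one>}"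
      unfolding has_finite_index_def by blast
    have "g \<in> T" if g: "g \<in> carrier G" for g
    proof -
      obtain t where t: "t \<in> T" "g \<otimes> inv t = \<one>" using T(3) g by auto
      then have "t \<in> carrier G" using T(2) by blast
      then have "g = t" using inv_equality[OF t(2)] g by simp
      then show ?thesis using t by simp
    qed
    then have "carrier G \<subseteq> T" by (rule subsetI)
    then show False using T(1) inf finite_subset by blast
  qed
  then have "?A \<noteq> {}" using one_is_normal by auto
  then have "\<exists>M\<in>?A. \<forall>X\<in>?A. M \<subseteq> X \<longrightarrow> X = M"
  proof (rule subset_Zorn_nonempty)
    fix C assume "C \<noteq> {}" "subset.chain ?A C"
    then show "\<Union>C \<in> ?A" using chain_Union_infinite_index[of C] chain_Union_normal[of C] by simp
  qed
  then obtain R where R: "R \<lhd> G" "\<not> has_finite_index G R"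
    and max: "\<And>X. X \<lhd> G \<Longrightarrow> \<not> has_finite_index G X \<Longrightarrow> R \<subseteq> X \<Longrightarrow> X = R"
    by auto
  show ?thesis
  proof (rule that[OF R])
    show "\<forall>N. N \<lhd> G \<longrightarrow> R \<subset> N \<longrightarrow> has_finite_index G N" using max by auto
  qed
qed

section \<open>Growth of normal closures modulo \<open>R\<close>\<close>

text \<open>Finite pieces of the normal closure of \<open>x\<close>. A set stable under the
  conjugations has a normal right stabilizer, and stability under multiplication by \<open>x\<close>
  and \<open>inv x\<close> puts \<open>x\<close> into it; the growth argument rests on this.\<close>

primrec closure_steps :: "'a \<Rightarrow> nat \<Rightarrow> 'a set" where
  "closure_steps x 0 = {\<one>}"
| "closure_steps x (Suc k) = closure_steps x k \<union> (\<lambda>a. a \<otimes> x) ` closure_steps x k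
     \<union> (\<lambda>a. a \<otimes> inv x) ` closure_steps x k
     \<union> (\<lambda>(s, a). s \<otimes> a \<otimes> inv s) ` (letters \<times> closure_steps x k)"

lemma finite_closure_steps: "finite (closure_steps x k)"
  using finite_letters by (induction k) auto

lemma closure_steps_subset_normal:
  assumes "N \<lhd> G" "x \<in> N"
  shows "closure_steps x k \<subseteq> N"
proof -
  interpret N: normal N G by fact
  show ?thesis
    using assms normal_conj[OF assms(1)] letters_carrier by (induction k) auto
qed

lemma closure_steps_carrier: "x \<in> carrier G \<Longrightarrow> closure_steps x k \<subseteq> carrier G"
  using letters_carrier by (induction k) auto

lemma one_in_closure_steps: "\<one> \<in> closure_steps x k"
  by (induction k) auto

text \<open>A multiplication adds at most \<open>l\<close> letters and a conjugation adds two;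
  \<open>l + 2\<close> bounds both.\<close>

lemma closure_steps_word_ball:
  assumes "x \<in> word_ball l"
  shows "closure_steps x k \<subseteq> word_ball (k * (l + 2))"
proof (induction k)
  case 0
  then show ?case using one_in_word_ball by simp
next
  case (Suc k)
  let ?K = "k * (l + 2)"
  show ?case
  proof
    fix b assume "b \<in> closure_steps x (Suc k)"
    then consider "b \<in> word_ball ?K"
      | a where "a \<in> word_ball ?K" "b = a \<otimes> x"
      | a where "a \<in> word_ball ?K" "b = a \<otimes> inv x"
      | s a where "s \<in> letters" "a \<in> word_ball ?K" "b = s \<otimes> a \<otimes> inv s"
      using Suc by auto
    then show "b \<in> word_ball (Suc k * (l + 2))"
    proof cases
      case 1
      then show ?thesis by (rule word_ball_mono) simp
    next
      case 2
      then have "b \<in> word_ball (?K + l)" using word_ball_mult assms by simp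
      then show ?thesis by (rule word_ball_mono) simp
    next
      case 3
      then have "b \<in> word_ball (?K + l)" using word_ball_mult word_ball_inv assms by simp
      then show ?thesis by (rule word_ball_mono) simp
    next
      case 4
      then have "b \<in> word_ball (1 + ?K + 1)"
        using word_ball_mult[OF word_ball_mult[OF letters_word_ball] letters_word_ball[OF letters_inv]] by simp
      then show ?thesis by (rule word_ball_mono) simp
    qed
  qed
qed

text \<open>The count starts at one and rises with every step: if some step produced no new coset of
  \<open>R\<close>, the union \<open>V\<close> of the cosets reached would be stable under all
  moves, which forces \<open>R\<close> to have finite index.\<close>

lemma card_cosets_closure_steps:
  assumes R: "R \<lhd> G" "\<not> has_finite_index G R" "\<forall>N. N \<lhd> G \<longrightarrow> R \<subset> N \<longrightarrow> has_finite_index G N"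
    and x: "x \<in> carrier G" "x \<notin> R"
  shows "k < card ((\<lambda>a. R #> a) ` closure_steps x k)"
proof -
  interpret R: normal R G by (rule R(1))
  let ?q = "\<lambda>k. (\<lambda>a. R #> a) ` closure_steps x k"
  have strict: "?q k \<noteq> ?q (Suc k)" for k
  proof
    assume eq: "?q k = ?q (Suc k)"
    let ?W = "closure_steps x k"
    have W: "?W \<subseteq> carrier G" "finite ?W"
      using closure_steps_carrier x finite_closure_steps by auto
    define V where "V = {g \<in> carrier G. \<exists>w\<in>?W. g \<otimes> inv w \<in> R}"
    \<comment> \<open>The equality of the two sets of cosets enters here: whatever one further move
      reaches is still in \<open>V\<close>.\<close>
    have VI: "r \<otimes> b \<in> V" if b: "b \<in> closure_steps x (Suc k)" and r: "r \<in> R" for b r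
    proof -
      have bc: "b \<in> carrier G" using b closure_steps_carrier x by blast
      have "R #> b \<in> ?q k" using eq b by blast
      then obtain w where w: "w \<in> ?W" "R #> b = R #> w" by blast
      then have "b \<otimes> inv w \<in> R" using normal_rcos_eq_iff[OF R(1) bc] W by blast
      then have "r \<otimes> (b \<otimes> inv w) \<in> R" using r by simp
      then have "r \<otimes> b \<otimes> inv w \<in> R" using bc subsetD[OF W(1) w(1)] r by (simp add: m_assoc)
      then show ?thesis using w(1) r bc unfolding V_def by auto
    qed
    have VE: "\<exists>r\<in>R. \<exists>w\<in>?W. v = r \<otimes> w" if v: "v \<in> V" for v
    proof -
      obtain w where w: "w \<in> ?W" "v \<otimes> inv w \<in> R" and vc: "v \<in> carrier G"
        using v unfolding V_def by blast
      have "v = (v \<otimes> inv w) \<otimes> w" using subsetD[OF W(1) w(1)] vc by (simp add: m_assoc)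
      then show ?thesis using w by (intro bexI)
    qed
    have V_carrier: "V \<subseteq> carrier G" unfolding V_def by blast
    have V_mult: "v \<otimes> x \<in> V" "v \<otimes> inv x \<in> V" if v: "v \<in> V" for v
    proof -
      obtain r w where rw: "r \<in> R" "w \<in> ?W" "v = r \<otimes> w" using VE[OF v] by blast
      have car: "r \<in> carrier G" "w \<in> carrier G" using rw W by auto
      have "r \<otimes> (w \<otimes> x) \<in> V" "r \<otimes> (w \<otimes> inv x) \<in> V"
        by (rule VI; use rw in simp)+
      then show "v \<otimes> x \<in> V" "v \<otimes> inv x \<in> V" using rw(3) car x by (simp_all add: m_assoc)
    qed
    have V_letter: "s \<otimes> v \<otimes> inv s \<in> V" if v: "v \<in> V" and s: "s \<in> letters" for v s
    proof -
      obtain r w where rw: "r \<in> R" "w \<in> ?W" "v = r \<otimes> w" using VE[OF v] by blast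
      have car: "s \<in> carrier G" "r \<in> carrier G" "w \<in> carrier G"
        using rw W s letters_carrier by auto
      \<comment> \<open>The conjugate splits into one of \<open>r\<close>, which stays in
        \<open>R\<close>, and one of \<open>w\<close>, which belongs to the next step.\<close>
      have "(s \<otimes> r \<otimes> inv s) \<otimes> (s \<otimes> w \<otimes> inv s) \<in> V"
      proof (rule VI)
        have "s \<otimes> w \<otimes> inv s \<in> (\<lambda>(s, a). s \<otimes> a \<otimes> inv s) ` (letters \<times> ?W)"
          using rw(2) s by (intro image_eqI[of _ _ "(s, w)"]) simp_all
        then show "s \<otimes> w \<otimes> inv s \<in> closure_steps x (Suc k)" by simp
      qed (rule normal_conj[OF R(1) car(1) rw(1)])
      then show ?thesis
        using rw(3) car by (simp add: m_assoc mult_inv_cancel_left)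
    qed
    \<comment> \<open>Stability under letters extends to all of \<open>G\<close>; this will make the
      stabilizer of \<open>V\<close> normal.\<close>
    have V_conj: "\<forall>v\<in>V. g \<otimes> v \<otimes> inv g \<in> V" if "g \<in> carrier G" for g
      using that
    proof (induction rule: carrier_induct)
      case one
      then show ?case using V_carrier by (auto simp: subset_iff)
    next
      case (letter s g)
      show ?case
      proof
        fix v assume v: "v \<in> V"
        have "s \<otimes> (g \<otimes> v \<otimes> inv g) \<otimes> inv s \<in> V"
          using V_letter[OF bspec[OF letter.IH v] letter.hyps(1)] .
        moreover have "s \<in> carrier G" "v \<in> carrier G"
          using letter letters_carrier v V_carrier by auto
        ultimately show "s \<otimes> g \<otimes> v \<otimes> inv (s \<otimes> g) \<in> V"
          using letter by (simp add: m_assoc inv_mult_group)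
      qed
    qed
    \<comment> \<open>The stabilizer \<open>H\<close> of \<open>V\<close> is a normal subgroup containing \<open>R\<close> and \<open>x\<close>, hence of finite index;
      but \<open>H \<subseteq> V\<close> is a finite union of cosets of \<open>R\<close>, so \<open>R\<close> would have finite index too.\<close>
    define H where "H = {h \<in> carrier G. \<forall>v\<in>V. v \<otimes> h \<in> V \<and> v \<otimes> inv h \<in> V}"
    have one_V: "\<one> \<in> V"
      unfolding V_def using one_in_closure_steps[of x k] by (auto intro!: bexI[of _ \<one>])
    have subH: "subgroup H G"
    proof (rule subgroupI)
      show "H \<subseteq> carrier G" unfolding H_def by blast
      have "\<one> \<in> H" unfolding H_def using V_carrier by (auto simp: subset_iff)
      then show "H \<noteq> {}" by blast
      show "inv a \<in> H" if "a \<in> H" for a using that unfolding H_def by auto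
      show "a \<otimes> b \<in> H" if ab: "a \<in> H" "b \<in> H" for a b
      proof -
        have car: "a \<in> carrier G" "b \<in> carrier G" using ab unfolding H_def by auto
        have "v \<otimes> (a \<otimes> b) \<in> V \<and> v \<otimes> inv (a \<otimes> b) \<in> V" if v: "v \<in> V" for v
        proof -
          have "v \<otimes> a \<otimes> b \<in> V" "v \<otimes> inv b \<otimes> inv a \<in> V"
            using v ab unfolding H_def by simp_all
          moreover have "v \<in> carrier G" using v V_carrier by blast
          ultimately show ?thesis using car by (simp add: m_assoc inv_mult_group)
        qed
        then show ?thesis using car unfolding H_def by simp
      qed
    qed
    have norH: "H \<lhd> G"
      unfolding normal_inv_iff
    proof (intro conjI ballI)
      show "subgroup H G" by (rule subH)
      fix g h assume g: "g \<in> carrier G" and h: "h \<in> H"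
      have hc: "h \<in> carrier G" using h unfolding H_def by blast
      have "v \<otimes> (g \<otimes> h \<otimes> inv g) \<in> V \<and> v \<otimes> inv (g \<otimes> h \<otimes> inv g) \<in> V" if v: "v \<in> V" for v
      proof -
        have vc: "v \<in> carrier G" using v V_carrier by blast
        have "inv g \<otimes> v \<otimes> inv (inv g) \<in> V" using bspec[OF V_conj[OF inv_closed[OF g]] v] .
        then have "inv g \<otimes> v \<otimes> g \<in> V" using g by simp
        \<comment> \<open>Right multiplication by a conjugate of \<open>h\<close> amounts to
          conjugating \<open>v\<close>, multiplying by \<open>h\<close> and conjugating
          back.\<close>
        then have "g \<otimes> (inv g \<otimes> v \<otimes> g \<otimes> h) \<otimes> inv g \<in> V" "g \<otimes> (inv g \<otimes> v \<otimes> g \<otimes> inv h) \<otimes> inv g \<in> V"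
          using bspec[OF V_conj[OF g]] h unfolding H_def by simp_all
        moreover have "g \<otimes> (inv g \<otimes> v \<otimes> g \<otimes> h) \<otimes> inv g = v \<otimes> (g \<otimes> h \<otimes> inv g)"
          "g \<otimes> (inv g \<otimes> v \<otimes> g \<otimes> inv h) \<otimes> inv g = v \<otimes> inv (g \<otimes> h \<otimes> inv g)"
          using g hc vc by (simp_all add: m_assoc inv_mult_group mult_inv_cancel_left)
        ultimately show ?thesis by simp
      qed
      then show "g \<otimes> h \<otimes> inv g \<in> H" using g hc unfolding H_def by auto
    qed
    have R_right: "v \<otimes> r \<in> V" if v: "v \<in> V" and r: "r \<in> R" for v r
    proof -
      obtain r' w where rw: "r' \<in> R" "w \<in> ?W" "v = r' \<otimes> w" using VE[OF v] by blast
      have car: "r' \<in> carrier G" "w \<in> carrier G" "r \<in> carrier G" using rw W r by auto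
      \<comment> \<open>Moving \<open>r\<close> to the left past \<open>w\<close> turns it into a
        conjugate, still in \<open>R\<close>.\<close>
      have "w \<otimes> r \<otimes> inv w \<in> R" using normal_conj[OF R(1) car(2) r] .
      then have "r' \<otimes> (w \<otimes> r \<otimes> inv w) \<otimes> w \<in> V" using rw by (intro VI) simp_all
      then show ?thesis using rw(3) car by (simp add: m_assoc)
    qed
    have "R \<subseteq> H" unfolding H_def using R_right by auto
    moreover have "x \<in> H" unfolding H_def using x V_mult by auto
    ultimately have "has_finite_index G H" using R(3) norH x(2) by blast
    then obtain T where T: "finite T" "T \<subseteq> carrier G" "\<forall>g\<in>carrier G. \<exists>t\<in>T. g \<otimes> inv t \<in> H"
      unfolding has_finite_index_def by blast
    \<comment> \<open>\<open>T\<close> represents \<open>G\<close> modulo \<open>H\<close>, and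
      \<open>?W\<close> represents \<open>V\<close>, hence \<open>H\<close>, modulo
      \<open>R\<close>; so the products \<open>w \<otimes> t\<close> represent \<open>G\<close>
      modulo \<open>R\<close>.\<close>
    have "\<exists>u\<in>(\<lambda>(w, t). w \<otimes> t) ` (?W \<times> T). g \<otimes> inv u \<in> R" if g: "g \<in> carrier G" for g
    proof -
      obtain t where t: "t \<in> T" "g \<otimes> inv t \<in> H" using T g by blast
      have "\<forall>v\<in>V. v \<otimes> (g \<otimes> inv t) \<in> V" using t(2) unfolding H_def by simp
      then have "\<one> \<otimes> (g \<otimes> inv t) \<in> V" using one_V by (rule bspec)
      moreover have tc: "t \<in> carrier G" using t T by blast
      ultimately have "g \<otimes> inv t \<in> V" using g by simp
      then obtain w where w: "w \<in> ?W" "g \<otimes> inv t \<otimes> inv w \<in> R" unfolding V_def by blast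
      moreover have "w \<in> carrier G" using w(1) W by blast
      ultimately have "g \<otimes> inv (w \<otimes> t) \<in> R" using g tc by (simp add: m_assoc inv_mult_group)
      then show ?thesis using w(1) t(1) by (intro bexI[of _ "w \<otimes> t"] image_eqI[of _ _ "(w, t)"]) simp_all
    qed
    moreover have "finite ((\<lambda>(w, t). w \<otimes> t) ` (?W \<times> T))" "(\<lambda>(w, t). w \<otimes> t) ` (?W \<times> T) \<subseteq> carrier G"
      using W T by auto
    ultimately have "has_finite_index G R" unfolding has_finite_index_def by blast
    then show False using R(2) by blast
  qed
  show ?thesis
  proof (induction k)
    case 0
    then show ?case by simp
  next
    case (Suc k)
    have "?q k \<subset> ?q (Suc k)" using strict[of k] by auto
    then have "card (?q k) < card (?q (Suc k))"
      using finite_closure_steps by (intro psubset_card_mono) blast+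
    then show ?case using Suc by linarith
  qed
qed

section \<open>Counting normal subgroups of bounded index\<close>

definition normal_upto :: "nat \<Rightarrow> 'a set set" where
  "normal_upto m = {N. N \<lhd> G \<and> finite (rcosets N) \<and> card (rcosets N) \<le> m}"

text \<open>Each \<open>N\<close> is encoded injectively by a table of
  \<open>card letters * m\<close> labels below \<open>m\<close> together with the label of the coset
  \<open>N\<close> itself; the latter accounts for the \<open>+ 1\<close> in the exponent.\<close>

lemma normal_upto_finite_card:
  assumes m: "m > 0"
  shows "finite (normal_upto m) \<and> card (normal_upto m) \<le> m ^ (card letters * m + 1)"
proof -
  have "\<exists>f. inj_on f (rcosets N) \<and> f ` (rcosets N) \<subseteq> {..<m}" if "N \<in> normal_upto m" for N
    using that card_le_inj[of "rcosets N" "{..<m}"] unfolding normal_upto_def by auto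
  then obtain f where f: "\<And>N. N \<in> normal_upto m \<Longrightarrow> inj_on (f N) (rcosets N)"
     "\<And>N. N \<in> normal_upto m \<Longrightarrow> f N ` (rcosets N) \<subseteq> {..<m}"
    by metis
  define c where "c N g = f N (N #> g)" for N g
  have cm: "c N g < m" if "N \<in> normal_upto m" "g \<in> carrier G" for N g
  proof -
    have "N #> g \<in> rcosets N" using that by (simp add: normal_upto_def normal_rcosetsI)
    then show ?thesis using f(2)[OF that(1)] unfolding c_def by blast
  qed
  have c_eq: "c N g = c N h \<longleftrightarrow> g \<otimes> inv h \<in> N"
    if N: "N \<in> normal_upto m" and gh: "g \<in> carrier G" "h \<in> carrier G" for N g h
  proof -
    have nor: "N \<lhd> G" using N unfolding normal_upto_def by blast
    have "c N g = c N h \<longleftrightarrow> N #> g = N #> h"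
      unfolding c_def using gh by (intro inj_on_eq_iff[OF f(1)[OF N]] normal_rcosetsI[OF nor])
    then show ?thesis using normal_rcos_eq_iff[OF nor gh] by simp
  qed
  \<comment> \<open>A label \<open>i\<close> that no coset carries gets an arbitrary group element,
    so that every entry of the table is still a label below \<open>m\<close>.\<close>
  define rep where "rep N i = (SOME g. g \<in> carrier G \<and> (c N g = i \<or> (\<forall>h\<in>carrier G. c N h \<noteq> i)))" for N i
  have rep: "rep N i \<in> carrier G \<and> (c N (rep N i) = i \<or> (\<forall>h\<in>carrier G. c N h \<noteq> i))" for N i
    unfolding rep_def
  proof (rule someI_ex)
    show "\<exists>g. g \<in> carrier G \<and> (c N g = i \<or> (\<forall>h\<in>carrier G. c N h \<noteq> i))"
      by (cases "\<exists>h\<in>carrier G. c N h = i") (auto intro: exI[of _ \<one>])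
  qed
  define enc where
    "enc N = (c N \<one>, restrict (\<lambda>(s, i). c N (s \<otimes> rep N i)) (letters \<times> {..<m}))" for N
  let ?X = "{..<m} \<times> ((letters \<times> {..<m}) \<rightarrow>\<^sub>E {..<m})"
  have sub: "enc ` normal_upto m \<subseteq> ?X"
  proof (rule image_subsetI)
    fix N assume N: "N \<in> normal_upto m"
    have "s \<otimes> rep N i \<in> carrier G" if "s \<in> letters" for s i
      using that rep[of N i] letters_carrier by auto
    then show "enc N \<in> ?X" unfolding enc_def using cm[OF N] by auto
  qed
  \<comment> \<open>Normality makes left multiplication by a letter well defined on right cosets, so
    the label of \<open>s \<otimes> g\<close> can be read off the table.\<close>
  have step: "c N (s \<otimes> g) = c N (s \<otimes> rep N (c N g))"
    if N: "N \<in> normal_upto m" and s: "s \<in> letters" and g: "g \<in> carrier G" for N s g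
  proof -
    have nor: "N \<lhd> G" using N unfolding normal_upto_def by blast
    let ?r = "rep N (c N g)"
    have rc: "?r \<in> carrier G" and "c N ?r = c N g" using rep[of N "c N g"] g by auto
    then have "g \<otimes> inv ?r \<in> N" using c_eq[OF N g, of ?r] by simp
    moreover have sc: "s \<in> carrier G" using s letters_carrier by blast
    ultimately have "s \<otimes> (g \<otimes> inv ?r) \<otimes> inv s \<in> N" by (intro normal_conj[OF nor])
    then have "s \<otimes> g \<otimes> inv (s \<otimes> ?r) \<in> N" using sc rc g by (simp add: m_assoc inv_mult_group)
    then show ?thesis using c_eq[OF N, of "s \<otimes> g" "s \<otimes> ?r"] sc rc g by simp
  qed
  \<comment> \<open>\<open>enc N\<close> is the transition table of the Schreier graph of \<open>N\<close>, which determines \<open>N\<close>.\<close>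
  have "inj_on enc (normal_upto m)"
  proof (rule inj_onI)
    fix M N assume M: "M \<in> normal_upto m" and N: "N \<in> normal_upto m" and eq: "enc M = enc N"
    have trans: "c M (s \<otimes> rep M i) = c N (s \<otimes> rep N i)" if "s \<in> letters" "i < m" for s i
    proof -
      have "snd (enc M) (s, i) = snd (enc N) (s, i)" using eq by simp
      then show ?thesis using that unfolding enc_def by simp
    qed
    have c1: "c M \<one> = c N \<one>" using eq unfolding enc_def by simp
    \<comment> \<open>Equal tables and equal starting labels propagate along words.\<close>
    have same: "c M g = c N g" if "g \<in> carrier G" for g
      using that
    proof (induction rule: carrier_induct)
      case one
      show ?case by (rule c1)
    next
      case (letter s g)
      then show ?case
        using step[OF M letter(1,2)] step[OF N letter(1,2)] trans[OF letter(1) cm[OF M letter(2)]] by simp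
    qed
    have mem: "g \<in> L \<longleftrightarrow> g \<in> carrier G \<and> c L g = c L \<one>" if L: "L \<in> normal_upto m" for L g
    proof -
      have "L \<subseteq> carrier G"
        using L by (auto simp: normal_upto_def dest!: normal_imp_subgroup dest: subgroup.mem_carrier)
      then show ?thesis using c_eq[OF L, of g \<one>] by auto
    qed
    show "M = N" using mem[OF M] mem[OF N] same c1 by auto
  qed
  moreover have fin: "finite ?X" using finite_letters by (intro finite_cartesian_product finite_PiE) auto
  moreover have "card ?X = m ^ (card letters * m + 1)"
    using finite_letters by (simp add: card_PiE card_cartesian_product)
  ultimately show ?thesis
    using sub card_inj_on_le[of enc "normal_upto m" ?X] inj_on_finite[of enc "normal_upto m" ?X] by simp
qed

section \<open>Descent to an element of all normal subgroups of small index\<close>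

text \<open>Two pigeonhole arguments: modulo \<open>N\<close> two of \<open>m + 1\<close> elements
  coincide, and of the at most \<open>(m + 1)^2\<close> pairs one serves at least an average share
  of the subgroups missing \<open>x\<close>. Staying outside \<open>R\<close> allows the step to be
  repeated.\<close>

lemma descent_step:
  assumes R: "R \<lhd> G" "\<not> has_finite_index G R" "\<forall>N. N \<lhd> G \<longrightarrow> R \<subset> N \<longrightarrow> has_finite_index G N"
    and x: "x \<in> word_ball l" "x \<notin> R" and l: "l > 0" and m: "m > 0"
  obtains h where "h \<in> word_ball (6 * m * l)" "h \<notin> R"
    "real (card {N \<in> normal_upto m. h \<notin> N})
       \<le> (1 - 1 / real ((m + 1)^2)) * real (card {N \<in> normal_upto m. x \<notin> N})"
proof -
  have xc: "x \<in> carrier G" using x word_ball_carrier by blast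
  let ?W = "closure_steps x m"
  have Wc: "?W \<subseteq> carrier G" using closure_steps_carrier xc by blast
  have "\<exists>A'\<subseteq>?W. inj_on (\<lambda>a. R #> a) A' \<and> (\<lambda>a. R #> a) ` ?W = (\<lambda>a. R #> a) ` A'"
    using subset_image_inj[of "(\<lambda>a. R #> a) ` ?W" "\<lambda>a. R #> a" ?W] by simp
  then obtain A' where A': "A' \<subseteq> ?W" "inj_on (\<lambda>a. R #> a) A'" "(\<lambda>a. R #> a) ` ?W = (\<lambda>a. R #> a) ` A'"
    by (elim exE conjE)
  have "m + 1 \<le> card A'"
    using card_cosets_closure_steps[OF R xc x(2), of m] card_image[OF A'(2)] by (simp only: A'(3))
  \<comment> \<open>Exactly \<open>m + 1\<close> elements: more than the index of any
    \<open>N\<close> in \<open>normal_upto m\<close>, and few enough to bound the number of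
    pairs.\<close>
  then obtain A where A: "A \<subseteq> A'" "card A = m + 1" "finite A"
    by (rule obtain_subset_with_card_n)
  have AW: "A \<subseteq> ?W" "inj_on (\<lambda>a. R #> a) A" using A(1) A'(1) inj_on_subset[OF A'(2) A(1)] by auto
  define P where "P = {(a, b). a \<in> A \<and> b \<in> A \<and> a \<noteq> b}"
  have P: "finite P" "card P \<le> (m + 1)^2"
  proof -
    have "P \<subseteq> A \<times> A" unfolding P_def by blast
    then show "finite P" "card P \<le> (m + 1)^2"
      using A(2,3) card_mono[of "A \<times> A" P] finite_subset[of P "A \<times> A"]
      by (simp_all add: card_cartesian_product power2_eq_square)
  qed
  define B where "B = {N \<in> normal_upto m. x \<notin> N}"
  have finB: "finite B" using normal_upto_finite_card[OF m] unfolding B_def by simp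
  have cover: "\<exists>p\<in>P. fst p \<otimes> inv (snd p) \<in> N" if N: "N \<in> B" for N
  proof -
    have nor: "N \<lhd> G" "finite (rcosets N)" "card (rcosets N) \<le> m"
      using N unfolding B_def normal_upto_def by auto
    have "(\<lambda>a. N #> a) ` A \<subseteq> rcosets N"
      using AW Wc by (auto intro!: normal_rcosetsI[OF nor(1)])
    then have "card ((\<lambda>a. N #> a) ` A) < card A"
      using card_mono[OF nor(2), of "(\<lambda>a. N #> a) ` A"] nor(3) A(2) by simp
    then have "\<not> inj_on (\<lambda>a. N #> a) A" by (rule pigeonhole)
    then obtain a b where "a \<in> A" "b \<in> A" "a \<noteq> b" "N #> a = N #> b" unfolding inj_on_def by blast
    then have "(a, b) \<in> P" "a \<otimes> inv b \<in> N"
      using normal_rcos_eq_iff[OF nor(1), of a b] AW Wc unfolding P_def by auto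
    then show ?thesis by (intro bexI[of _ "(a, b)"]) simp_all
  qed
  define Bp where "Bp p = {N \<in> B. fst p \<otimes> inv (snd p) \<in> N}" for p
  have P_ne: "P \<noteq> {}"
  proof
    assume "P = {}"
    then have "\<forall>a\<in>A. \<forall>b\<in>A. a = b" unfolding P_def by blast
    then have "card A \<le> 1" using card_le_Suc0_iff_eq[OF A(3)] by simp
    then show False using A m by simp
  qed
  have "\<exists>p\<in>P. card B \<le> (m + 1)^2 * card (Bp p)"
  proof -
    \<comment> \<open>The best pair does at least as well as the average.\<close>
    define M where "M = Max ((\<lambda>p. card (Bp p)) ` P)"
    have "B \<subseteq> (\<Union>p\<in>P. Bp p)" using cover unfolding Bp_def by blast
    then have "card B \<le> card (\<Union>p\<in>P. Bp p)"
      using P finB unfolding Bp_def by (intro card_mono) auto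
    also have "\<dots> \<le> (\<Sum>p\<in>P. card (Bp p))" by (rule card_UN_le[OF P(1)])
    also have "\<dots> \<le> card P * M"
      using sum_bounded_above[of P "\<lambda>p. card (Bp p)" M] P(1) by (simp add: M_def)
    also have "\<dots> \<le> (m + 1)^2 * M" using P by simp
    finally have "card B \<le> (m + 1)^2 * M" .
    moreover have "M \<in> (\<lambda>p. card (Bp p)) ` P" unfolding M_def using P P_ne by (intro Max_in) auto
    ultimately show ?thesis by blast
  qed
  then obtain a b where p: "(a, b) \<in> P" "card B \<le> (m + 1)^2 * card (Bp (a, b))" by auto
  have ab: "a \<in> A" "b \<in> A" "a \<noteq> b" using p unfolding P_def by auto
  then have abc: "a \<in> carrier G" "b \<in> carrier G" using AW Wc by blast+
  show thesis
  proof (rule that[of "a \<otimes> inv b"])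
    have "a \<in> word_ball (m * (l + 2))" "b \<in> word_ball (m * (l + 2))"
      using subsetD[OF closure_steps_word_ball[OF x(1)], of _ m] ab AW by auto
    then have "a \<otimes> inv b \<in> word_ball (m * (l + 2) + m * (l + 2))"
      by (intro word_ball_mult word_ball_inv)
    moreover have "m * (l + 2) + m * (l + 2) \<le> 6 * m * l"
    proof -
      \<comment> \<open>Here \<open>l + 2 \<le> 3 * l\<close> because \<open>l \<ge> 1\<close>;
        taking a quotient of two such elements doubles the 3 to 6.\<close>
      have "m * (l + 2) \<le> m * (3 * l)" using l by (intro mult_left_mono) auto
      then show ?thesis by simp
    qed
    ultimately show "a \<otimes> inv b \<in> word_ball (6 * m * l)" by (rule word_ball_mono)
    show "a \<otimes> inv b \<notin> R"
      using normal_rcos_eq_iff[OF R(1) abc] inj_onD[OF AW(2) _ ab(1,2)] ab(3) by auto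
    \<comment> \<open>No progress is lost: a normal subgroup containing \<open>x\<close> contains
      \<open>a\<close> and \<open>b\<close>, which lie in the normal closure of
      \<open>x\<close>.\<close>
    have "{N \<in> normal_upto m. a \<otimes> inv b \<notin> N} \<subseteq> B - Bp (a, b)"
    proof
      fix N assume N: "N \<in> {N \<in> normal_upto m. a \<otimes> inv b \<notin> N}"
      then have nor: "N \<lhd> G" unfolding normal_upto_def by blast
      have "x \<notin> N"
      proof
        assume "x \<in> N"
        then have "a \<in> N" "b \<in> N" using subsetD[OF closure_steps_subset_normal[OF nor]] AW ab by auto
        then have "a \<otimes> inv b \<in> N"
          using subgroup.m_closed[OF normal_imp_subgroup[OF nor]]
            subgroup.m_inv_closed[OF normal_imp_subgroup[OF nor]] by simp
        then show False using N by blast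
      qed
      then show "N \<in> B - Bp (a, b)" using N unfolding B_def Bp_def by auto
    qed
    then have "card {N \<in> normal_upto m. a \<otimes> inv b \<notin> N} \<le> card (B - Bp (a, b))"
      using finB by (intro card_mono) auto
    also have "\<dots> = card B - card (Bp (a, b))"
      using finB unfolding Bp_def by (intro card_Diff_subset) auto
    finally have "real (card {N \<in> normal_upto m. a \<otimes> inv b \<notin> N}) \<le> real (card B) - real (card (Bp (a, b)))"
      using card_mono[OF finB, of "Bp (a, b)"] by (simp add: Bp_def of_nat_diff)
    also have "\<dots> \<le> (1 - 1 / real ((m + 1)^2)) * real (card B)"
    proof -
      have "real (card B) \<le> real ((m + 1)^2) * real (card (Bp (a, b)))"
        unfolding of_nat_mult[symmetric] using p(2) by (rule of_nat_mono)
      moreover have "real ((m + 1)^2) > 0" by simp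
      ultimately have "real (card B) / real ((m + 1)^2) \<le> real (card (Bp (a, b)))"
        by (simp add: divide_le_eq mult.commute)
      then show ?thesis by (simp add: algebra_simps)
    qed
    finally show "real (card {N \<in> normal_upto m. a \<otimes> inv b \<notin> N})
       \<le> (1 - 1 / real ((m + 1)^2)) * real (card {N \<in> normal_upto m. x \<notin> N})"
      unfolding B_def .
  qed
qed

text \<open>Every \<open>(m + 1)^2\<close> descent steps shrink the bound on the number of missed
  subgroups at least by the factor \<open>exp (- 1)\<close>, and
  \<open>(card letters + 1) * m^2\<close> such rounds beat the initial number, leaving fewer than
  one.\<close>

lemma short_element_in_all_normal_upto:
  assumes inf: "infinite (carrier G)" and m: "m > 0"
  obtains h where "h \<in> word_ball ((6 * m) ^ ((m + 1)^2 * (card letters + 1) * m^2))" "h \<noteq> \<one>"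
    "\<And>N. N \<in> normal_upto m \<Longrightarrow> h \<in> N"
proof -
  obtain R where R: "R \<lhd> G" "\<not> has_finite_index G R" "\<forall>N. N \<lhd> G \<longrightarrow> R \<subset> N \<longrightarrow> has_finite_index G N"
    using ex_maximal_infinite_index[OF inf] .
  interpret R: normal R G by (rule R(1))
  \<comment> \<open>The descent starts at a letter outside \<open>R\<close>; without one,
    \<open>R\<close> would be all of \<open>G\<close>.\<close>
  have "\<not> letters \<subseteq> R"
  proof
    assume *: "letters \<subseteq> R"
    have "g \<in> R" if "g \<in> carrier G" for g
      using that by (induction rule: carrier_induct) (use * in auto)
    then have "has_finite_index G R" unfolding has_finite_index_def by (intro exI[of _ "{\<one>}"]) auto
    then show False using R(2) by blast
  qed
  then obtain x0 where x0: "x0 \<in> letters" "x0 \<notin> R" by blast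
  let ?q = "1 - 1 / real ((m + 1)^2)" and ?D = "card letters"
  have "\<exists>x. x \<in> word_ball ((6 * m) ^ k) \<and> x \<notin> R \<and>
      real (card {N \<in> normal_upto m. x \<notin> N}) \<le> ?q ^ k * real (card (normal_upto m))" for k
  proof (induction k)
    case 0
    have "card {N \<in> normal_upto m. x0 \<notin> N} \<le> card (normal_upto m)"
      using normal_upto_finite_card[OF m] by (intro card_mono) auto
    \<comment> \<open>A letter has length at most \<open>1 = (6 * m) ^ 0\<close>.\<close>
    then show ?case using x0 letters_word_ball by (intro exI[of _ x0]) auto
  next
    case (Suc k)
    then obtain x where x: "x \<in> word_ball ((6 * m) ^ k)" "x \<notin> R"
      "real (card {N \<in> normal_upto m. x \<notin> N}) \<le> ?q ^ k * real (card (normal_upto m))" by blast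
    have "(6 * m) ^ k > 0" using m by simp
    then obtain h where h: "h \<in> word_ball (6 * m * (6 * m) ^ k)" "h \<notin> R"
      "real (card {N \<in> normal_upto m. h \<notin> N}) \<le> ?q * real (card {N \<in> normal_upto m. x \<notin> N})"
      by (rule descent_step[OF R x(1,2) _ m])
    have "?q * real (card {N \<in> normal_upto m. x \<notin> N}) \<le> ?q * (?q ^ k * real (card (normal_upto m)))"
      using x(3) by (intro mult_left_mono) auto
    then show ?case using h by (intro exI[of _ h]) (auto simp: mult.assoc)
  qed
  then obtain x where x: "x \<in> word_ball ((6 * m) ^ ((m + 1)^2 * (?D + 1) * m^2))" "x \<notin> R"
    "real (card {N \<in> normal_upto m. x \<notin> N})
       \<le> ?q ^ ((m + 1)^2 * (?D + 1) * m^2) * real (card (normal_upto m))"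
    by blast
  have "?q ^ ((m + 1)^2) \<le> exp (- 1)"
  proof -
    \<comment> \<open>This is \<open>1 - t \<le> exp (- t)\<close> at
      \<open>t = 1 / (m + 1)^2\<close>.\<close>
    have "?q ^ ((m + 1)^2) \<le> exp (- (1 / real ((m + 1)^2))) ^ ((m + 1)^2)"
      using exp_ge_add_one_self[of "- (1 / real ((m + 1)^2))"] by (intro power_mono) auto
    also have "\<dots> = exp (real ((m + 1)^2) * - (1 / real ((m + 1)^2)))"
      by (rule exp_of_nat_mult[symmetric])
    also have "real ((m + 1)^2) * - (1 / real ((m + 1)^2)) = - 1" by simp
    finally show ?thesis .
  qed
  then have "(?q ^ ((m + 1)^2)) ^ ((?D + 1) * m^2) \<le> exp (- 1) ^ ((?D + 1) * m^2)"
    by (intro power_mono) auto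
  also have "\<dots> = exp (- real ((?D + 1) * m^2))"
    by (simp add: exp_of_nat_mult[symmetric] mult.commute)
  finally have q: "?q ^ ((m + 1)^2 * (?D + 1) * m^2) \<le> exp (- real ((?D + 1) * m^2))"
    by (simp only: power_mult mult.assoc)
  have "real (card (normal_upto m)) \<le> real (m ^ (?D * m + 1))"
    using normal_upto_finite_card[OF m] of_nat_le_iff by blast
  also have "\<dots> = real m ^ (?D * m + 1)" by simp
  \<comment> \<open>From \<open>m < m + 1 \<le> exp m\<close>. Strictness matters: the final count
    must be strictly below 1 to vanish.\<close>
  also have "\<dots> < exp (real m) ^ (?D * m + 1)"
    using m less_le_trans[OF _ exp_ge_add_one_self[of "real m"], of "real m"] by (intro power_strict_mono) auto
  also have "\<dots> = exp (real (?D * m + 1) * real m)" by (rule exp_of_nat_mult[symmetric])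
  also have "\<dots> \<le> exp (real ((?D + 1) * m^2))"
  proof -
    have "(?D * m + 1) * m \<le> (?D + 1) * m^2" using m by (simp add: power2_eq_square algebra_simps)
    then have "real ((?D * m + 1) * m) \<le> real ((?D + 1) * m^2)" by (rule of_nat_mono)
    then show ?thesis by (simp only: of_nat_mult exp_le_cancel_iff)
  qed
  finally have c: "real (card (normal_upto m)) < exp (real ((?D + 1) * m^2))" .
  have "real (card {N \<in> normal_upto m. x \<notin> N})
      \<le> exp (- real ((?D + 1) * m^2)) * real (card (normal_upto m))"
    using x(3) mult_right_mono[OF q, of "real (card (normal_upto m))"] by linarith
  also have "\<dots> < exp (- real ((?D + 1) * m^2)) * exp (real ((?D + 1) * m^2))"
    using c by (intro mult_strict_left_mono) auto
  also have "\<dots> = 1" by (simp flip: exp_add)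
  finally have "card {N \<in> normal_upto m. x \<notin> N} = 0" by simp
  then have "{N \<in> normal_upto m. x \<notin> N} = {}"
    using normal_upto_finite_card[OF m] by simp
  moreover have "x \<noteq> \<one>" using x(2) by auto
  ultimately show ?thesis using that x(1) by blast
qed

section \<open>Lower bounds for the divisibility growth\<close>

text \<open>The short element lies in every normal subgroup of index at most \<open>m\<close>, so
  any that omits it has index at least \<open>m + 1\<close>.\<close>

lemma divisibility_growth_lower_nat:
  assumes inf: "infinite (carrier G)" and m: "m > 0"
    and n: "n \<ge> exp (24 * (real (card letters) + 1) * real m ^ 5)"
  shows "divisibility_growth G S n \<ge> enat (m + 1)"
proof -
  let ?D = "card letters"
  let ?k = "(m + 1)^2 * (?D + 1) * m^2"
  obtain h where h: "h \<in> word_ball ((6 * m) ^ ?k)" "h \<noteq> \<one>" "\<And>N. N \<in> normal_upto m \<Longrightarrow> h \<in> N"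
    using short_element_in_all_normal_upto[OF inf m] by metis
  have "real ((6 * m) ^ ?k) = real (6 * m) ^ ?k" by simp
  also have "\<dots> \<le> exp (real (6 * m)) ^ ?k"
    using exp_ge_add_one_self[of "real (6 * m)"] by (intro power_mono) linarith+
  also have "\<dots> = exp (real ?k * real (6 * m))" by (rule exp_of_nat_mult[symmetric])
  also have "\<dots> \<le> exp (24 * (real ?D + 1) * real m ^ 5)"
  proof -
    \<comment> \<open>The constant is \<open>24 = 2^2 * 6\<close>, from
      \<open>m + 1 \<le> 2 * m\<close> and the base \<open>6 * m \<le> exp (6 * m)\<close>.\<close>
    have "(m + 1)^2 \<le> (2 * m)^2" using m by (intro power_mono) auto
    then have "?k * (6 * m) \<le> (2 * m)^2 * (?D + 1) * m^2 * (6 * m)"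
      by (intro mult_right_mono) auto
    also have "\<dots> = 24 * (?D + 1) * m ^ 5" by (simp add: power2_eq_square eval_nat_numeral algebra_simps)
    finally have "real (?k * (6 * m)) \<le> real (24 * (?D + 1) * m ^ 5)" by (rule of_nat_mono)
    then have "real ?k * real (6 * m) \<le> 24 * (real ?D + 1) * real m ^ 5"
      by (simp only: of_nat_mult of_nat_add of_nat_power of_nat_numeral of_nat_1)
    then show ?thesis by simp
  qed
  also have "\<dots> \<le> n" by (rule n)
  finally have "real (word_length G S h) \<le> n"
    using word_length_le[OF h(1)] by (meson of_nat_mono order.trans)
  then have hb: "h \<in> punctured_ball G S n"
    using h word_ball_carrier unfolding punctured_ball_def by auto
  have "enat (m + 1) \<le> normal_divisibility G h"
    unfolding normal_divisibility_def
  \<comment> \<open>This also covers an empty set of indices, whose infimum is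
    \<open>\<infinity>\<close>.\<close>
  proof (rule Inf_greatest)
    fix e assume "e \<in> {enat (card (rcosets N)) |N. N \<lhd> G \<and> finite (rcosets N) \<and> h \<notin> N}"
    then obtain N where "e = enat (card (rcosets N))" "N \<lhd> G" "finite (rcosets N)" "h \<notin> N" by blast
    then show "enat (m + 1) \<le> e" using h(3)[of N] unfolding normal_upto_def by fastforce
  qed
  also have "\<dots> \<le> (SUP g\<in>punctured_ball G S n. normal_divisibility G g)" using hb by (rule SUP_upper)
  finally show ?thesis unfolding divisibility_growth_def using hb by auto
qed

text \<open>Inverts the threshold of the preceding lemma: the largest admissible \<open>m\<close> is
  the integer part of a fifth root, and \<open>n \<ge> exp c\<close> makes it at least 1.\<close>

lemma divisibility_growth_lower:
  assumes inf: "infinite (carrier G)"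
  obtains c :: real where "c > 0"
    "\<And>n. n \<ge> exp c \<Longrightarrow> ereal ((ln n / c) powr (1/5)) \<le> ereal_of_enat (divisibility_growth G S n)"
proof
  define c where "c = 24 * (real (card letters) + 1)"
  show c0: "c > 0" unfolding c_def by simp
  fix n assume n: "n \<ge> exp c"
  then have n0: "n > 0" using exp_gt_zero less_le_trans by blast
  have lnn: "ln n \<ge> c" using n n0 by (simp add: ln_ge_iff)
  define y where "y = (ln n / c) powr (1/5)"
  \<comment> \<open>Rounding down costs nothing, because the preceding lemma yields
    \<open>m + 1\<close>, which is at least \<open>y\<close>.\<close>
  define m where "m = nat \<lfloor>y\<rfloor>"
  have y1: "y \<ge> 1" unfolding y_def using lnn c0 by (intro ge_one_powr_ge_zero) auto
  then have m: "m > 0" and my: "real m \<le> y" "y \<le> real (m + 1)" unfolding m_def by linarith+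
  have "real m ^ 5 \<le> y ^ 5" using my by (intro power_mono) auto
  also have "\<dots> = ln n / c" unfolding y_def using lnn c0 by (simp add: powr_power)
  finally have "c * real m ^ 5 \<le> ln n" using c0 by (simp add: field_simps)
  then have "n \<ge> exp (c * real m ^ 5)" using n0 by (metis exp_le_cancel_iff exp_ln)
  then have F: "enat (m + 1) \<le> divisibility_growth G S n"
    using divisibility_growth_lower_nat[OF inf m] unfolding c_def by simp
  have "ereal y \<le> ereal_of_enat (enat (m + 1))" using my by simp
  also have "\<dots> \<le> ereal_of_enat (divisibility_growth G S n)" using F by (simp only: ereal_of_enat_le_iff)
  finally show "ereal ((ln n / c) powr (1/5)) \<le> ereal_of_enat (divisibility_growth G S n)"
    unfolding y_def .
qed

end

section \<open>From the lower bound to the asymptotic statements\<close>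

lemma ln_enat_lower:
  assumes "ereal y \<le> ereal_of_enat e" "y > 0"
  shows "ereal (ln y) \<le> ln_enat e"
  using assms by (cases e) auto

theorem mainTheorem4:
  fixes G :: "('a, 'b) monoid_scheme" and S :: "'a set"
  assumes "group G"
    and "finite S" and "S \<subseteq> carrier G" and "generate G S = carrier G"
  shows "(Limsup at_top (\<lambda>n::real. (ln_enat (divisibility_growth G S n))\<^sup>2 / ereal (ln (ln n))) = 0
            \<longrightarrow> finite (carrier G)) \<and>
         (infinite (carrier G) \<longrightarrow>
            (\<lambda>n. ereal (exp (sqrt (ln (ln n))))) \<preceq> (\<lambda>n. ereal_of_enat (divisibility_growth G S n)))"
proof -
  interpret finitely_generated_group G S
    using assms by (simp add: finitely_generated_group_def finitely_generated_group_axioms_def)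
  \<comment> \<open>For infinite \<open>G\<close> both conclusions are proved; the first claim
    follows by contraposition.\<close>
  have "Limsup at_top (\<lambda>n::real. (ln_enat (divisibility_growth G S n))\<^sup>2 / ereal (ln (ln n))) \<noteq> 0
      \<and> (\<lambda>n. ereal (exp (sqrt (ln (ln n))))) \<preceq> (\<lambda>n. ereal_of_enat (divisibility_growth G S n))"
    if inf: "infinite (carrier G)"
  proof
    obtain c :: real where c: "c > 0"
      "\<And>n. n \<ge> exp c \<Longrightarrow> ereal ((ln n / c) powr (1/5)) \<le> ereal_of_enat (divisibility_growth G S n)"
      using divisibility_growth_lower[OF inf] by metis
    have large: "\<forall>\<^sub>F n in at_top. n \<ge> exp c" by (rule eventually_ge_at_top)
    \<comment> \<open>The logarithm of the bound is \<open>(ln (ln n) - ln c) / 5\<close>, whose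
      square eventually exceeds \<open>ln (ln n)\<close>.\<close>
    have "\<forall>\<^sub>F n::real in at_top. 0 < ln n / c \<and> 0 < ln (ln n) \<and> 0 < ln ((ln n / c) powr (1/5))
        \<and> ln (ln n) \<le> (ln ((ln n / c) powr (1/5)))\<^sup>2"
      using c(1) by (intro eventually_conj; real_asymp)
    with large have "\<forall>\<^sub>F n::real in at_top. 1 \<le> (ln_enat (divisibility_growth G S n))\<^sup>2 / ereal (ln (ln n))"
    proof eventually_elim
      case (elim n)
      define z where "z = ln ((ln n / c) powr (1/5))"
      have z: "z > 0" "ln (ln n) \<le> z\<^sup>2" "ln (ln n) > 0" using elim unfolding z_def by auto
      have "ereal z \<le> ln_enat (divisibility_growth G S n)"
        unfolding z_def using elim by (intro ln_enat_lower c(2)) auto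
      \<comment> \<open>Products in \<open>ereal\<close> are monotone for nonnegative factors, which
        \<open>z > 0\<close> ensures.\<close>
      then have "ereal z * ereal z \<le> ln_enat (divisibility_growth G S n) * ln_enat (divisibility_growth G S n)"
        using z by (intro ereal_mult_mono) (auto intro: order.trans[of 0 "ereal z"])
      moreover have "ereal (ln (ln n)) \<le> ereal z * ereal z" using z by (simp add: power2_eq_square)
      ultimately have "ereal (ln (ln n)) \<le> (ln_enat (divisibility_growth G S n))\<^sup>2"
        unfolding power2_eq_square by (rule order.trans[rotated])
      then show ?case using z by (simp add: ereal_le_divide_pos)
    qed
    then have "1 \<le> Limsup at_top (\<lambda>n::real. (ln_enat (divisibility_growth G S n))\<^sup>2 / ereal (ln (ln n)))"
      by (intro le_Limsup) auto
    then show "Limsup at_top (\<lambda>n::real. (ln_enat (divisibility_growth G S n))\<^sup>2 / ereal (ln (ln n))) \<noteq> 0"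
      by auto
    \<comment> \<open>After taking logarithms, \<open>sqrt (ln (ln n))\<close> is compared with
      \<open>(ln (ln n) - ln c) / 5\<close>, which grows faster.\<close>
    have "\<forall>\<^sub>F n::real in at_top. exp (sqrt (ln (ln n))) \<le> (ln n / c) powr (1/5)"
      using c(1) by real_asymp
    with large have "\<forall>\<^sub>F n in at_top. ereal (exp (sqrt (ln (ln n)))) \<le> ereal_of_enat (divisibility_growth G S n)"
    proof eventually_elim
      case (elim n)
      then show ?case using c(2)[of n] by (meson ereal_less_eq(3) order.trans)
    qed
    \<comment> \<open>The constant \<open>C = 1\<close> suffices.\<close>
    then show "(\<lambda>n. ereal (exp (sqrt (ln (ln n))))) \<preceq> (\<lambda>n. ereal_of_enat (divisibility_growth G S n))"
      unfolding asymp_preceq_def by (intro exI[of _ 1]) (simp add: one_ereal_def[symmetric])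
  qed
  then show ?thesis by blast
qed

end
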